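(* Let $\theta_1<\dots<\theta_m$ be real numbers and let $s\in\mathbb{R}$ be distinct from $\theta_1,\dots,\theta_m$. Let $k_1,k_m$, $I_k\subset\{1,\dots,m\}$ and $R_k\subset\mathbb{R}$ ($k=1,\dots,m$) be as defined in the context, and put $R_{m+1}:=R_1$ and $\mathbb{R}_s:=\mathbb{R}\setminus\{s\}$. Then for every $k\in\{1,\dots,m\}\setminus\{k_m\}$ there exist rational functions $r_{\{+,k\}}$ and $r_{\{-,k\}}$, each of the form $p(\lambda)/(\lambda-s)^{2m-2}$ with a polynomial $p$ of degree $\le 2m-2$, such that $$r_{\{+,k\}}(\theta_j)=r_{\{-,k\}}(\theta_j)=\begin{cases}1,& j\in I_k,\\ 0,& j\in\{1,\dots,m\}\setminus I_k,\end{cases}$$ and $$r_{\{+,k\}}(\lambda)\ge\begin{cases}1,&\lambda\in R_k,\\0,&\lambda\in\mathbb{R}_s\setminus R_k,\end{cases}\qquad r_{\{-,k\}}(\lambda)\le\begin{cases}1,&\lambda\in R_{k+1}^{\mathrm{o}},\\0,&\lambda\in\mathbb{R}_s\setminus R_{k+1}^{\mathrm{o}}.\end{cases}$$ Moreover, these inequalities are strict for every $\lambda\in\mathbb{R}_s\setminus\{\theta_1,\dots,\theta_m\}$.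
   Context: The inequalities include the assertion that $r_{\{\pm,k\}}$ are real-valued on $\mathbb{R}_s$. $R^{\mathrm{o}}$ denotes the interior of $R$. Indices: if $s\in(\theta_1,\theta_m)$, then $k_m$ and $k_1$ are defined by $\theta_{k_m}<s<\theta_{k_1}$, $k_1=k_m+1$. If $s<\theta_1$ or $s>\theta_m$, then $k_1=1$ and $k_m=m$. Sets, for $k=1,\dots,m$: $I_k=\{k_1,\dots,k\}$ if $k_1\le k\le m$, and $I_k=\{1,\dots,k\}\cup\{k_1,\dots,m\}$ if $1\le k<k_1$; $R_k=(s,\theta_k]$ if $\theta_k>s$, and $R_k=(-\infty,\theta_k]\cup(s,\infty)$ if $\theta_k<s$. *)

theory Defs
  imports
    "HOL-Analysis.Elementary_Topology"
    "HOL-Computational_Algebra.Polynomial"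
    "HOL-Library.Complex_Order"
begin

text \<open>
  The nodes are the values \<open>\<theta> 1 < \<dots> < \<theta> m\<close>; other values of \<open>\<theta>\<close> are irrelevant.
\<close>

text \<open>If \<open>s\<close> lies strictly between the extreme nodes (and is not a node), the index below exists and
  is unique.\<close>

definition k_last :: "(nat \<Rightarrow> real) \<Rightarrow> nat \<Rightarrow> real \<Rightarrow> nat" where
  "k_last \<theta> m s =
     (if \<theta> 1 < s \<and> s < \<theta> m
      then (THE k. k \<in> {1..m} \<and> k + 1 \<in> {1..m} \<and> \<theta> k < s \<and> s < \<theta> (k + 1))
      else m)"

definition k_first :: "(nat \<Rightarrow> real) \<Rightarrow> nat \<Rightarrow> real \<Rightarrow> nat" where
  "k_first \<theta> m s = (if \<theta> 1 < s \<and> s < \<theta> m then k_last \<theta> m s + 1 else 1)"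

definition I_set :: "(nat \<Rightarrow> real) \<Rightarrow> nat \<Rightarrow> real \<Rightarrow> nat \<Rightarrow> nat set" where
  "I_set \<theta> m s k =
     (if k_first \<theta> m s \<le> k then {k_first \<theta> m s..k} else {1..k} \<union> {k_first \<theta> m s..m})"

text \<open>The index \<open>m + 1\<close> is read cyclically: \<open>R\<^bsub>m+1\<^esub> = R\<^sub>1\<close>.\<close>

definition R_set :: "(nat \<Rightarrow> real) \<Rightarrow> nat \<Rightarrow> real \<Rightarrow> nat \<Rightarrow> real set" where
  "R_set \<theta> m s k =
     (let j = (if k = m + 1 then 1 else k)
      in if s < \<theta> j then {s<..\<theta> j} else {..\<theta> j} \<union> {s<..})"

text \<open>
  Rational functions \<open>p(z) / (z - s)\<^bsup>2m-2\<^esup>\<close> with a complex polynomial \<open>p\<close> of degree at most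
  \<open>2m - 2\<close>, regarded as functions away from the only possible pole \<open>s\<close>. Their being real-valued on
  the real line is part of the inequalities: in the order on the complex numbers used here,
  \<open>z \<le> w\<close> means \<open>Re z \<le> Re w\<close> and \<open>Im z = Im w\<close>, and \<open>z < w\<close> means \<open>Re z < Re w\<close> and
  \<open>Im z = Im w\<close>.
\<close>

definition ratfun_at :: "real \<Rightarrow> nat \<Rightarrow> (complex \<Rightarrow> complex) \<Rightarrow> bool" where
  "ratfun_at s m r \<longleftrightarrow>
     (\<exists>p :: complex poly. degree p \<le> 2 * m - 2 \<and>
        (\<forall>z. z \<noteq> of_real s \<longrightarrow> r z = poly p z / (z - of_real s) ^ (2 * m - 2)))"

end

(* The substitution t = 1 / (s - x) turns the problem into one-sided polynomial approximation of the
   step function with jump at a node c (Markov-Stieltjes): R_k becomes the half-line t <= t_k.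
   Put W(t) = prod (y - t)^2 over the nodes y > c, and let U be the Hermite interpolant of 1/W, double
   at the nodes x < c and simple at c. On t < min y the function 1/W has positive divided differences
   of all orders, so the interpolation error 1/W - U has the sign of t - c there, and the Newton form
   shows U > 0 for t > c. Hence W * U is the majorant; the minorant arises by reflection t -> -t. *)
theory Submission
  imports Defs "HOL-Analysis.Convex_Euclidean_Space"
begin

section \<open>Functions with positive divided differences\<close>

text \<open>
  This cone contains the functions 1/W above. It is closed under multiplication and, unlike
  absolute monotonicity, gives positivity of all divided differences at points left of \<open>Y\<close> by
  a purely algebraic induction.
\<close>

inductive pos_pole_fun :: "real set \<Rightarrow> (real \<Rightarrow> real) \<Rightarrow> bool" for Y where
  pole: "y \<in> Y \<Longrightarrow> pos_pole_fun Y (\<lambda>t. 1 / (y - t))"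
| times: "pos_pole_fun Y f \<Longrightarrow> pos_pole_fun Y g \<Longrightarrow> pos_pole_fun Y (\<lambda>t. f t * g t)"
| plus: "pos_pole_fun Y f \<Longrightarrow> pos_pole_fun Y g \<Longrightarrow> pos_pole_fun Y (\<lambda>t. f t + g t)"
| scale: "pos_pole_fun Y f \<Longrightarrow> c > 0 \<Longrightarrow> pos_pole_fun Y (\<lambda>t. c * f t)"

lemma pos_pole_fun_pos:
  assumes "pos_pole_fun Y f" "\<forall>y\<in>Y. t < y"
  shows "f t > 0"
  using assms by induction (auto intro: add_pos_pos)

text \<open>The witness \<open>g\<close> is the divided difference of \<open>f\<close> at
  \<open>x\<close> and \<open>t\<close>. For a pole it is the same pole scaled by 1/(y - x) > 0;
  sums and multiples are immediate, and products follow the Leibniz rule. Points of \<open>Y\<close>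
  are excluded because division by zero gives the pole the value 0 there.\<close>

lemma pos_pole_fun_divided_difference:
  assumes "pos_pole_fun Y f" "\<forall>y\<in>Y. x < y"
  shows "\<exists>g. pos_pole_fun Y g \<and> (\<forall>t. t \<notin> Y \<longrightarrow> f t = f x + (t - x) * g t)"
  using assms
proof induction
  case (pole y)
  define g where "g = (\<lambda>t. 1 / (y - x) * (1 / (y - t)))"
  have "pos_pole_fun Y g"
    unfolding g_def using pole by (intro pos_pole_fun.scale pos_pole_fun.pole) auto
  moreover have "1 / (y - t) = 1 / (y - x) + (t - x) * g t" if "t \<notin> Y" for t
  proof -
    have "y - t \<noteq> 0" "y - x \<noteq> 0" using that pole by auto
    then show ?thesis unfolding g_def by (simp add: divide_simps)
  qed
  ultimately show ?case by blast
next
  case (times f h)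
  then obtain f1 h1 where
    1: "pos_pole_fun Y f1" "\<And>t. t \<notin> Y \<Longrightarrow> f t = f x + (t - x) * f1 t" and
    2: "pos_pole_fun Y h1" "\<And>t. t \<notin> Y \<Longrightarrow> h t = h x + (t - x) * h1 t" by blast
  define g where "g = (\<lambda>t. f t * h1 t + h x * f1 t)"
  have "h x > 0" using pos_pole_fun_pos[OF times.hyps(2) times.prems] .
  then have "pos_pole_fun Y g"
    unfolding g_def
    by (rule pos_pole_fun.plus[OF pos_pole_fun.times[OF times.hyps(1) 2(1)] pos_pole_fun.scale[OF 1(1)]])
  moreover have "f t * h t = f x * h x + (t - x) * g t" if "t \<notin> Y" for t
    unfolding g_def using 1(2)[OF that] 2(2)[OF that] by algebra
  ultimately show ?case by blast
next
  case (plus f h)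
  then obtain f1 h1 where
    1: "pos_pole_fun Y f1" "\<And>t. t \<notin> Y \<Longrightarrow> f t = f x + (t - x) * f1 t" and
    2: "pos_pole_fun Y h1" "\<And>t. t \<notin> Y \<Longrightarrow> h t = h x + (t - x) * h1 t" by blast
  have "f t + h t = (f x + h x) + (t - x) * (f1 t + h1 t)" if "t \<notin> Y" for t
    using 1(2)[OF that] 2(2)[OF that] by algebra
  then show ?case using pos_pole_fun.plus[OF 1(1) 2(1)] by blast
next
  case (scale f c)
  then obtain f1 where
    1: "pos_pole_fun Y f1" "\<And>t. t \<notin> Y \<Longrightarrow> f t = f x + (t - x) * f1 t" by blast
  have "c * f t = c * f x + (t - x) * (c * f1 t)" if "t \<notin> Y" for t
    using 1(2)[OF that] by algebra
  then show ?case using pos_pole_fun.scale[OF 1(1) scale(2)] by blast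
qed

text \<open>The empty product is excluded because the constant 1 is outside the cone: every member
  tends to 0 at infinity.\<close>

lemma pos_pole_fun_prod:
  assumes "finite Z" "Z \<noteq> {}" "Z \<subseteq> Y"
  shows "pos_pole_fun Y (\<lambda>t. \<Prod>y\<in>Z. 1 / (y - t) * (1 / (y - t)))"
  using assms
proof (induction rule: finite_ne_induct)
  case (singleton y)
  then have "pos_pole_fun Y (\<lambda>t. 1 / (y - t))" by (intro pos_pole_fun.pole) simp
  from pos_pole_fun.times[OF this this] show ?case by simp
next
  case (insert y F)
  then have y: "y \<in> Y" and F: "pos_pole_fun Y (\<lambda>t. \<Prod>y\<in>F. 1 / (y - t) * (1 / (y - t)))" by auto
  have "pos_pole_fun Y (\<lambda>t. 1 / (y - t) * (1 / (y - t)))"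
    by (rule pos_pole_fun.times[OF pos_pole_fun.pole[OF y] pos_pole_fun.pole[OF y]])
  from pos_pole_fun.times[OF this F]
  show ?case unfolding prod.insert[OF insert.hyps(1,3)] .
qed

text \<open>Iterated divided differences along \<open>xs\<close> give Newton's formula, and repeated
  entries give Hermite interpolation. The Newton coefficients are values of cone members left of
  \<open>Y\<close>, hence positive; right of all nodes the Newton basis products are nonnegative and
  the first one is 1. This bounds \<open>U\<close> below even for \<open>t\<close> beyond
  \<open>Y\<close>.\<close>

lemma newton_interpolation_pos_pole_fun:
  assumes "pos_pole_fun Y f" "\<forall>x\<in>set xs. \<forall>y\<in>Y. x < y"
  shows "\<exists>U g. pos_pole_fun Y g \<and> degree U \<le> length xs - 1 \<and> (xs = [] \<longrightarrow> U = 0) \<and>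
     (\<forall>t. t \<notin> Y \<longrightarrow> f t = poly U t + (\<Prod>x\<leftarrow>xs. t - x) * g t) \<and>
     (\<forall>t. xs \<noteq> [] \<longrightarrow> (\<forall>x\<in>set xs. x \<le> t) \<longrightarrow> poly U t > 0)"
  using assms
proof (induction xs arbitrary: f)
  case Nil
  then show ?case by (intro exI[of _ 0] exI[of _ f]) auto
next
  case (Cons x xs)
  obtain f1 where f1: "pos_pole_fun Y f1" "\<And>t. t \<notin> Y \<Longrightarrow> f t = f x + (t - x) * f1 t"
    using pos_pole_fun_divided_difference[OF Cons.prems(1), of x] Cons.prems(2) by auto
  obtain U g where U: "pos_pole_fun Y g" "degree U \<le> length xs - 1" "xs = [] \<longrightarrow> U = 0"
     "\<And>t. t \<notin> Y \<Longrightarrow> f1 t = poly U t + (\<Prod>x\<leftarrow>xs. t - x) * g t"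
     "\<And>t. xs \<noteq> [] \<Longrightarrow> (\<forall>x\<in>set xs. x \<le> t) \<Longrightarrow> poly U t > 0"
  proof -
    have "\<forall>x\<in>set xs. \<forall>y\<in>Y. x < y" using Cons.prems(2) by simp
    from Cons.IH[OF f1(1) this] show thesis using that by blast
  qed
  define V where "V = [:f x:] + [:-x, 1:] * U"
  \<comment> \<open>For a single node the truncated bound \<open>length xs - 1\<close> is 0, which
    would only give degree 1 for \<open>V\<close>; the clause forcing \<open>U = 0\<close> repairs
    this.\<close>
  have "degree V \<le> length xs"
  proof (cases "xs = []")
    case False
    have "degree ([:-x, 1:] * U) \<le> 1 + degree U"
      using degree_mult_le[of "[:-x, 1:]" U] by simp
    then have "degree ([:-x, 1:] * U) \<le> length xs" using U(2) False by (cases xs) auto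
    then show ?thesis unfolding V_def by (intro degree_add_le) auto
  qed (use U in \<open>auto simp: V_def\<close>)
  moreover have "f t = poly V t + (\<Prod>x\<leftarrow>x # xs. t - x) * g t" if "t \<notin> Y" for t
    unfolding V_def using f1(2)[OF that] U(4)[OF that] by (simp add: algebra_simps)
  moreover have "poly V t > 0" if "\<forall>z\<in>set (x # xs). z \<le> t" for t
  proof -
    have "poly U t \<ge> 0" using U(3) U(5)[of t] that by (cases "xs = []") auto
    moreover have "f x > 0" using pos_pole_fun_pos[OF Cons.prems(1)] Cons.prems(2) by auto
    moreover have "(t - x) * poly U t \<ge> 0" using that calculation(1) by simp
    ultimately show ?thesis by (simp add: V_def left_diff_distrib)
  qed
  ultimately show ?case using U(1) by (intro exI[of _ V] exI[of _ g]) auto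
qed

section \<open>One-sided polynomial approximation of a step function\<close>

text \<open>With \<open>X\<close> and \<open>Y\<close> the nodes below and above \<open>c\<close>,
  the degrees of \<open>U\<close> and \<open>W\<close> are at most 2 card X and 2 card Y, which add
  up to 2 card N - 2. A node above \<open>c\<close> puts 1/W into the cone.\<close>

lemma step_majorant:
  fixes N :: "real set"
  assumes N: "finite N" "c \<in> N" "\<exists>y\<in>N. c < y"
  shows "\<exists>Q. degree Q \<le> 2 * card N - 2 \<and>
     (\<forall>t\<in>N. poly Q t = (if t \<le> c then 1 else 0)) \<and>
     (\<forall>t. t \<notin> N \<longrightarrow> poly Q t > (if t \<le> c then 1 else 0))"
proof -
  define X where "X = {x\<in>N. x < c}"
  define Y where "Y = {y\<in>N. c < y}"
  have fin: "finite X" "finite Y" using N by (auto simp: X_def Y_def)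
  have NXY: "N = insert c (X \<union> Y)" using N(2) by (auto simp: X_def Y_def)
  have card: "card N = Suc (card X + card Y)"
    unfolding NXY using fin by (subst card_insert_disjoint) (auto simp: X_def Y_def card_Un_disjoint disjoint_iff)
  define xl where "xl = sorted_list_of_set X"
  \<comment> \<open>Double nodes below \<open>c\<close> make the node polynomial (t - c) times a
    square, so its sign changes only at \<open>c\<close>.\<close>
  define xs where "xs = c # xl @ xl"
  have xl: "set xl = X" "length xl = card X" "distinct xl" using fin by (auto simp: xl_def)
  define f where "f = (\<lambda>t. \<Prod>y\<in>Y. 1 / (y - t) * (1 / (y - t)))"
  have f: "pos_pole_fun Y f"
    unfolding f_def by (rule pos_pole_fun_prod) (use fin N in \<open>auto simp: Y_def\<close>)
  have "\<forall>x\<in>set xs. \<forall>y\<in>Y. x < y" by (auto simp: xs_def xl X_def Y_def)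
  from newton_interpolation_pos_pole_fun[OF f this] obtain U g where U:
    "pos_pole_fun Y g" "degree U \<le> length xs - 1"
    "\<And>t. t \<notin> Y \<Longrightarrow> f t = poly U t + (\<Prod>x\<leftarrow>xs. t - x) * g t"
    "\<And>t. xs \<noteq> [] \<Longrightarrow> (\<forall>x\<in>set xs. x \<le> t) \<Longrightarrow> poly U t > 0" by blast
  define P where "P = (\<lambda>t. (\<Prod>x\<in>X. (t - x)))"
  have P: "(\<Prod>x\<leftarrow>xs. t - x) = (t - c) * (P t)\<^sup>2" for t
    using prod.distinct_set_conv_list[OF xl(3), of "\<lambda>x. t - x"]
    by (simp add: xs_def P_def xl power2_eq_square)
  define W where "W = (\<Prod>y\<in>Y. [:y, -1:] * [:y, -1:])"
  have W: "poly W t = (\<Prod>y\<in>Y. (y - t) * (y - t))" for t by (simp add: W_def poly_prod algebra_simps)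
  have W_nonneg: "poly W t \<ge> 0" for t unfolding W by (intro prod_nonneg) auto
  have W_zero: "poly W t = 0 \<longleftrightarrow> t \<in> Y" for t unfolding W using fin by auto
  have W_f: "poly W t * f t = 1" if "t \<notin> Y" for t
  proof -
    have "poly W t * f t = (\<Prod>y\<in>Y. ((y - t) * (y - t)) * (1 / (y - t) * (1 / (y - t))))"
      unfolding W f_def by (simp only: prod.distrib)
    also have "\<dots> = 1" using that by (intro prod.neutral) auto
    finally show ?thesis .
  qed
  have degW: "degree W \<le> 2 * card Y"
  proof -
    have "degree W \<le> (\<Sum>y\<in>Y. degree ([:y, -1:] * [:y, -1:]))"
      unfolding W_def using fin(2) by (rule degree_prod_sum_le[unfolded o_def])
    also have "\<dots> = (\<Sum>y\<in>Y. 2)" by (intro sum.cong refl) (subst degree_mult_eq, auto)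
    finally show ?thesis by simp
  qed
  \<comment> \<open>Newton's remainder multiplied by \<open>W\<close>: off \<open>Y\<close>, the
    deviation of \<open>W * U\<close> from 1 is (c - t) g(t) times a nonnegative factor.\<close>
  have eq: "poly (W * U) t = 1 - poly W t * ((t - c) * (P t)\<^sup>2 * g t)" if "t \<notin> Y" for t
  proof -
    have "poly U t = f t - (t - c) * (P t)\<^sup>2 * g t" using U(3)[OF that] P by simp
    then have "poly (W * U) t = poly W t * f t - poly W t * ((t - c) * (P t)\<^sup>2 * g t)"
      by (simp add: right_diff_distrib)
    then show ?thesis using W_f[OF that] by simp
  qed
  have "degree (W * U) \<le> 2 * card N - 2"
    using degree_mult_le[of W U] degW U(2) card xl(2) by (simp add: xs_def)
  moreover have "poly (W * U) t = (if t \<le> c then 1 else 0)" if "t \<in> N" for t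
  proof (cases "t \<in> Y")
    case True
    then show ?thesis using W_zero by (auto simp: Y_def)
  next
    case False
    then have "t = c \<or> t \<in> X" using that NXY by auto
    then have "(t - c) * (P t)\<^sup>2 = 0" "t \<le> c" using fin by (auto simp: P_def X_def)
    then show ?thesis using eq[OF False] by simp
  qed
  moreover have "poly (W * U) t > (if t \<le> c then 1 else 0)" if "t \<notin> N" for t
  proof (cases "t \<le> c")
    case True
    have tY: "t \<notin> Y" using that NXY by auto
    have "t < c" using True that N by (cases "t = c") auto
    moreover have "(P t)\<^sup>2 > 0" using that NXY fin by (auto simp: P_def)
    moreover have "g t > 0" using pos_pole_fun_pos[OF U(1)] \<open>t < c\<close> by (auto simp: Y_def)
    moreover have "poly W t > 0" using W_nonneg[of t] W_zero[of t] tY by linarith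
    ultimately have "poly W t * ((t - c) * (P t)\<^sup>2 * g t) < 0"
      by (intro mult_pos_neg mult_neg_pos) auto
    then show ?thesis using eq[OF tY] True by simp
  next
    case False
    \<comment> \<open>Right of \<open>c\<close> the bound to beat is 0, so positivity of the Newton
      form suffices; it also holds past points of \<open>Y\<close>, where the sign of
      \<open>g\<close> is not controlled.\<close>
    have "poly U t > 0" using False by (intro U(4)) (auto simp: xs_def xl X_def)
    moreover have "t \<notin> Y" using that NXY by auto
    then have "poly W t > 0" using W_nonneg[of t] W_zero[of t] by linarith
    ultimately show ?thesis using False by simp
  qed
  ultimately show ?thesis by blast
qed

text \<open>Take 1 - Q(-t), with \<open>Q\<close> the majorant for the negated nodes and jump at -d.
  Complementing the closed half-line t >= d leaves an open one, hence the strict t < d here.\<close>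

lemma step_minorant:
  fixes N :: "real set"
  assumes N: "finite N" "d \<in> N" "\<exists>y\<in>N. y < d"
  shows "\<exists>Q. degree Q \<le> 2 * card N - 2 \<and>
     (\<forall>t\<in>N. poly Q t = (if t < d then 1 else 0)) \<and>
     (\<forall>t. t \<notin> N \<longrightarrow> poly Q t < (if t < d then 1 else 0))"
proof -
  have "card (uminus ` N) = card N" by (intro card_image inj_onI) auto
  moreover have "finite (uminus ` N)" "- d \<in> uminus ` N" "\<exists>y\<in>uminus ` N. - d < y" using N by auto
  ultimately obtain Q where Q: "degree Q \<le> 2 * card N - 2"
     "\<And>t. t \<in> uminus ` N \<Longrightarrow> poly Q t = (if t \<le> - d then 1 else 0)"
     "\<And>t. t \<notin> uminus ` N \<Longrightarrow> poly Q t > (if t \<le> - d then 1 else 0)"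
    using step_majorant[of "uminus ` N" "- d"] by metis
  define V where "V = 1 - pcompose Q [:0, -1:]"
  have V: "poly V t = 1 - poly Q (- t)" for t by (simp add: V_def poly_pcompose)
  have "degree V \<le> 2 * card N - 2"
    unfolding V_def using Q(1) degree_pcompose_le[of Q "[:0, -1:]"] by (intro degree_diff_le) auto
  moreover have "poly V t = (if t < d then 1 else 0)" if "t \<in> N" for t
    using Q(2)[of "- t"] that by (auto simp: V)
  moreover have "poly V t < (if t < d then 1 else 0)" if "t \<notin> N" for t
  proof -
    have "- t \<notin> uminus ` N" using that by auto
    from Q(3)[OF this] show ?thesis by (auto simp: V split: if_splits)
  qed
  ultimately show ?thesis by blast
qed

section \<open>Transfer to rational functions\<close>

text \<open>Multiplying by (z - s)^(2m - 2) clears all denominators of a polynomial of degree at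
  most 2m - 2 in 1/(s - z).\<close>

lemma ratfun_at_poly_inverse:
  fixes Q :: "real poly"
  assumes "degree Q \<le> 2 * m - 2"
  shows "ratfun_at s m (\<lambda>z. poly (map_poly of_real Q) (1 / (of_real s - z)))"
proof -
  let ?n = "2 * m - 2" and ?Q = "map_poly complex_of_real Q"
  \<comment> \<open>The sign (-1)^i comes from 1/(s - z) = -1/(z - s).\<close>
  define p where "p = (\<Sum>i\<le>?n. smult (coeff ?Q i * (-1) ^ i) ([:- complex_of_real s, 1:] ^ (?n - i)))"
  have deg: "degree p \<le> ?n"
    unfolding p_def
  proof (intro degree_sum_le)
    fix i
    have "degree ([:- complex_of_real s, 1:] ^ (?n - i)) \<le> ?n"
      by (simp add: degree_linear_power)
    then show "degree (smult (coeff ?Q i * (-1) ^ i) ([:- complex_of_real s, 1:] ^ (?n - i))) \<le> ?n"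
      using degree_smult_le order_trans by blast
  qed simp
  have "poly ?Q (1 / (of_real s - z)) = poly p z / (z - of_real s) ^ ?n"
    if z: "z \<noteq> of_real s" for z
  proof -
    have nz: "z - of_real s \<noteq> 0" using z by simp
    have "degree ?Q \<le> ?n" using assms by (simp add: degree_map_poly)
    then have "poly ?Q (1 / (of_real s - z)) = (\<Sum>i\<le>?n. coeff ?Q i * (1 / (of_real s - z)) ^ i)"
      unfolding poly_altdef by (intro sum.mono_neutral_left) (auto simp: coeff_eq_0)
    also have "\<dots> = (\<Sum>i\<le>?n. coeff ?Q i * (-1) ^ i * (z - of_real s) ^ (?n - i) / (z - of_real s) ^ ?n)"
    proof (intro sum.cong refl)
      fix i assume "i \<in> {..?n}"
      then have "(z - of_real s) ^ ?n = (z - of_real s) ^ (?n - i) * (z - of_real s) ^ i"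
        by (metis atMost_iff le_add_diff_inverse2 power_add)
      moreover have "1 / (of_real s - z) = (-1) * (1 / (z - of_real s))"
        using nz z by (simp add: field_simps)
      ultimately show "coeff ?Q i * (1 / (of_real s - z)) ^ i
          = coeff ?Q i * (-1) ^ i * (z - of_real s) ^ (?n - i) / (z - of_real s) ^ ?n"
        using nz by (simp only: power_mult_distrib) (simp add: power_one_over field_simps)
    qed
    also have "\<dots> = poly p z / (z - of_real s) ^ ?n"
      by (simp add: p_def poly_sum sum_divide_distrib)
    finally show ?thesis .
  qed
  with deg show ?thesis unfolding ratfun_at_def by blast
qed

section \<open>The cyclic order of the nodes\<close>

text \<open>The map x -> 1/(s - x) increases on each side of \<open>s\<close> and sends x > s to
  negative and x < s to positive values. It thus unrolls the cyclic order starting just right of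
  \<open>s\<close> into the usual order.\<close>

lemma R_set_iff:
  assumes "x \<noteq> s" "j = (if k = m + 1 then 1 else k)" "\<theta> j \<noteq> s"
  shows "x \<in> R_set \<theta> m s k \<longleftrightarrow> 1 / (s - x) \<le> 1 / (s - \<theta> j)"
  using assms unfolding R_set_def Let_def
  by (auto simp: divide_simps not_le)

lemma interior_R_set_iff:
  assumes "x \<noteq> s" "j = (if k = m + 1 then 1 else k)" "\<theta> j \<noteq> s"
  shows "x \<in> interior (R_set \<theta> m s k) \<longleftrightarrow> 1 / (s - x) < 1 / (s - \<theta> j)"
proof -
  have "x \<in> interior (R_set \<theta> m s k) \<longleftrightarrow> x \<in> R_set \<theta> m s k \<and> x \<noteq> \<theta> j"
  proof (cases "s < \<theta> j")
    case True
    then have "R_set \<theta> m s k = {s<..\<theta> j}" using assms(2) by (auto simp: R_set_def)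
    then show ?thesis by auto
  next
    case False
    \<comment> \<open>The interior of a complement is the complement of the closure, here of the
      closed interval from \<theta>(j) to \<open>s\<close>; apart from \<open>s\<close> itself only
      \<theta>(j) is lost.\<close>
    then have *: "R_set \<theta> m s k = - {\<theta> j<..s}" using assms(2) by (auto simp: R_set_def)
    have "\<theta> j < s" using False assms(3) by simp
    then show ?thesis unfolding * interior_complement using assms(1) by auto
  qed
  then show ?thesis using R_set_iff[of x s j k m \<theta>] assms by (auto simp: order_less_le)
qed

text \<open>Replaces the definite description by the position of \<open>s\<close> relative to each
  node. The two outer cases share the same indices, because the cyclic order is then simply 1, ...,
  m.\<close>

lemma k_last_cases:
  assumes m: "1 \<le> m" and mono: "strict_mono_on {1..m} \<theta>" and s: "s \<notin> \<theta> ` {1..m}"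
  obtains
    (inner) "k_first \<theta> m s = k_last \<theta> m s + 1" "k_last \<theta> m s \<in> {1..<m}"
      "\<And>j. j \<in> {1..m} \<Longrightarrow> s < \<theta> j \<longleftrightarrow> k_last \<theta> m s < j"
  | (left) "k_first \<theta> m s = 1" "k_last \<theta> m s = m" "\<And>j. j \<in> {1..m} \<Longrightarrow> s < \<theta> j"
  | (right) "k_first \<theta> m s = 1" "k_last \<theta> m s = m" "\<And>j. j \<in> {1..m} \<Longrightarrow> \<theta> j < s"
proof -
  have less: "\<theta> i < \<theta> j" if "i < j" "i \<in> {1..m}" "j \<in> {1..m}" for i j
    using mono that by (auto simp: strict_mono_on_def)
  have le: "\<theta> i \<le> \<theta> j" if "i \<le> j" "i \<in> {1..m}" "j \<in> {1..m}" for i j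
    using less[of i j] that by (cases "i = j") auto
  have ne: "\<theta> j \<noteq> s" if "j \<in> {1..m}" for j using s that by blast
  show ?thesis
  proof (cases "\<theta> 1 < s \<and> s < \<theta> m")
    case True
    let ?P = "\<lambda>k. k \<in> {1..m} \<and> k + 1 \<in> {1..m} \<and> \<theta> k < s \<and> s < \<theta> (k + 1)"
    define A where "A = {j\<in>{1..m}. \<theta> j < s}"
    have A: "finite A" "1 \<in> A" using True m by (auto simp: A_def)
    define K where "K = Max A"
    have K: "K \<in> A" unfolding K_def using A by (intro Max_in) auto
    have "K \<noteq> m" using K True by (auto simp: A_def)
    then have K1: "K + 1 \<in> {1..m}" using K by (auto simp: A_def)
    have "K + 1 \<notin> A" using Max_ge[OF A(1), of "K + 1"] unfolding K_def by linarith
    then have "s < \<theta> (K + 1)" using K1 ne[OF K1] by (auto simp: A_def)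
    then have PK: "?P K" using K K1 by (auto simp: A_def)
    \<comment> \<open>By monotonicity any admissible \<open>k\<close> determines which nodes exceed
      \<open>s\<close>; testing this at \<open>K\<close> and \<open>K + 1\<close> gives
      uniqueness.\<close>
    have iff: "s < \<theta> j \<longleftrightarrow> k < j" if "?P k" "j \<in> {1..m}" for j k
      using le[of j k] le[of "k + 1" j] that by (cases "k < j") auto
    have "k = K" if "?P k" for k
      using iff[OF that, of K] iff[OF that, of "K + 1"] PK by auto
    with PK have "(THE k. ?P k) = K" by (rule the_equality)
    then have last: "k_last \<theta> m s = K" using True by (simp add: k_last_def)
    show ?thesis
    proof (rule inner)
      show "k_first \<theta> m s = k_last \<theta> m s + 1" using True by (simp add: k_first_def)
      show "k_last \<theta> m s \<in> {1..<m}" using PK last by auto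
      show "s < \<theta> j \<longleftrightarrow> k_last \<theta> m s < j" if "j \<in> {1..m}" for j
        using iff[OF PK that] last by simp
    qed
  next
    case False
    then have "k_first \<theta> m s = 1" "k_last \<theta> m s = m" by (auto simp: k_first_def k_last_def)
    moreover have "(\<forall>j\<in>{1..m}. s < \<theta> j) \<or> (\<forall>j\<in>{1..m}. \<theta> j < s)"
    proof (cases "s < \<theta> 1")
      case True
      then show ?thesis using le[of 1] by fastforce
    next
      case F: False
      then have "\<theta> m < s" using False ne[of 1] ne[of m] m by auto
      then show ?thesis using le[of _ m] by fastforce
    qed
    ultimately show ?thesis using left right by blast
  qed
qed

text \<open>Both sides say that \<theta>(j) lies in R_k.\<close>

lemma I_set_iff:
  assumes "1 \<le> m" and mono: "strict_mono_on {1..m} \<theta>" and s: "s \<notin> \<theta> ` {1..m}"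
    and j: "j \<in> {1..m}" and k: "k \<in> {1..m}"
  shows "j \<in> I_set \<theta> m s k \<longleftrightarrow> 1 / (s - \<theta> j) \<le> 1 / (s - \<theta> k)"
proof -
  have ne: "\<theta> i \<noteq> s" if "i \<in> {1..m}" for i using s that by blast
  have le: "\<theta> j \<le> \<theta> k \<longleftrightarrow> j \<le> k" using strict_mono_on_less_eq[OF mono j k] .
  have "1 / (s - \<theta> j) \<le> 1 / (s - \<theta> k) \<longleftrightarrow> \<theta> j \<in> R_set \<theta> m s k"
    using R_set_iff[of "\<theta> j" s k k m \<theta>] ne[OF j] ne[OF k] k by auto
  also have "\<dots> \<longleftrightarrow> j \<in> I_set \<theta> m s k"
    using assms(1-3)
  proof (cases rule: k_last_cases)
    case inner
    show ?thesis using inner(3)[OF j] inner(3)[OF k] inner(1,2) j k le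
      by (auto simp: R_set_def I_set_def)
  next
    case left
    show ?thesis using left(3)[OF j] left(3)[OF k] left(1,2) j k le
      by (auto simp: R_set_def I_set_def)
  next
    case right
    show ?thesis using right(3)[OF j] right(3)[OF k] right(1,2) j k le
      by (auto simp: R_set_def I_set_def)
  qed
  finally show ?thesis by blast
qed

text \<open>In the order of the values 1/(s - \<theta>(j)), the index \<open>k'\<close> immediately
  follows \<open>k\<close>; only \<open>k_last\<close>, which carries the largest value, has no
  successor. So the closed half-line for R_k and the open one for the interior of R_(k+1) contain
  the same nodes.\<close>

lemma cyclic_successor_iff:
  assumes "1 \<le> m" and mono: "strict_mono_on {1..m} \<theta>" and s: "s \<notin> \<theta> ` {1..m}"
    and j: "j \<in> {1..m}" and k: "k \<in> {1..m}" "k \<noteq> k_last \<theta> m s"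
    and k': "k' = (if k + 1 = m + 1 then 1 else k + 1)"
  shows "1 / (s - \<theta> j) \<le> 1 / (s - \<theta> k) \<longleftrightarrow> 1 / (s - \<theta> j) < 1 / (s - \<theta> k')"
proof -
  have k'm: "k' \<in> {1..m}" using k k' by auto
  have "\<theta> k' \<noteq> s" "\<theta> j \<noteq> s" using s k'm j by blast+
  \<comment> \<open>Negating the strict inequality turns the claim into a purely combinatorial one:
    \<open>k'\<close> is outside I_j exactly when \<open>j\<close> is in I_k.\<close>
  then have "1 / (s - \<theta> j) < 1 / (s - \<theta> k') \<longleftrightarrow> \<not> 1 / (s - \<theta> k') \<le> 1 / (s - \<theta> j)" by auto
  also have "\<dots> \<longleftrightarrow> k' \<notin> I_set \<theta> m s j" using I_set_iff[OF assms(1-3) k'm j] by simp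
  also have "\<dots> \<longleftrightarrow> j \<in> I_set \<theta> m s k"
    using assms(1-3)
  proof (cases rule: k_last_cases)
    case inner
    show ?thesis using inner(1,2) j k k' by (auto simp: I_set_def)
  next
    case left
    show ?thesis using left(1,2) j k k' by (auto simp: I_set_def)
  next
    case right
    show ?thesis using right(1,2) j k k' by (auto simp: I_set_def)
  qed
  finally show ?thesis using I_set_iff[OF assms(1-3) j k(1)] by simp
qed

theorem proposition4p12:
  fixes \<theta> :: "nat \<Rightarrow> real" and m :: nat and s :: real
  assumes "1 \<le> m"
    and "strict_mono_on {1..m} \<theta>"
    and "s \<notin> \<theta> ` {1..m}"
  shows "\<forall>k \<in> {1..m} - {k_last \<theta> m s}.
    \<exists>r_plus r_minus :: complex \<Rightarrow> complex.
      ratfun_at s m r_plus \<and> ratfun_at s m r_minus \<and>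
      (\<forall>j \<in> {1..m}.
         r_plus (of_real (\<theta> j)) = (if j \<in> I_set \<theta> m s k then 1 else 0) \<and>
         r_minus (of_real (\<theta> j)) = (if j \<in> I_set \<theta> m s k then 1 else 0)) \<and>
      (\<forall>x :: real. x \<noteq> s \<longrightarrow>
         r_plus (of_real x) \<ge> (if x \<in> R_set \<theta> m s k then 1 else 0) \<and>
         r_minus (of_real x) \<le> (if x \<in> interior (R_set \<theta> m s (k + 1)) then 1 else 0)) \<and>
      (\<forall>x :: real. x \<noteq> s \<and> x \<notin> \<theta> ` {1..m} \<longrightarrow>
         r_plus (of_real x) > (if x \<in> R_set \<theta> m s k then 1 else 0) \<and>
         r_minus (of_real x) < (if x \<in> interior (R_set \<theta> m s (k + 1)) then 1 else 0))"
proof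
  fix k assume "k \<in> {1..m} - {k_last \<theta> m s}"
  then have k: "k \<in> {1..m}" "k \<noteq> k_last \<theta> m s" by auto
  define k' where "k' = (if k + 1 = m + 1 then 1 else k + 1)"
  have k': "k' \<in> {1..m}" using k by (auto simp: k'_def)
  define \<tau> where "\<tau> x = 1 / (s - x)" for x
  define N where "N = \<tau> ` \<theta> ` {1..m}"
  have ne: "\<theta> j \<noteq> s" if "j \<in> {1..m}" for j using assms(3) that by blast
  \<comment> \<open>This includes x = s: there division by zero gives 0, a value taken nowhere
    else.\<close>
  have \<tau>_inj: "\<tau> x = \<tau> y \<longleftrightarrow> x = y" for x y by (auto simp: \<tau>_def)
  have "inj_on \<theta> {1..m}" using assms(2) by (rule strict_mono_on_imp_inj_on)
  then have cardN: "card N = m"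
    unfolding N_def by (subst card_image) (auto intro: inj_onI simp: \<tau>_inj card_image)
  have I: "j \<in> I_set \<theta> m s k \<longleftrightarrow> \<tau> (\<theta> j) \<le> \<tau> (\<theta> k)" if "j \<in> {1..m}" for j
    using I_set_iff[OF assms that k(1)] by (simp add: \<tau>_def)
  have succ: "\<tau> (\<theta> j) \<le> \<tau> (\<theta> k) \<longleftrightarrow> \<tau> (\<theta> j) < \<tau> (\<theta> k')" if "j \<in> {1..m}" for j
    using cyclic_successor_iff[OF assms that k k'_def] by (simp add: \<tau>_def)
  have R: "x \<in> R_set \<theta> m s k \<longleftrightarrow> \<tau> x \<le> \<tau> (\<theta> k)"
    "x \<in> interior (R_set \<theta> m s (k + 1)) \<longleftrightarrow> \<tau> x < \<tau> (\<theta> k')" if "x \<noteq> s" for x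
    using R_set_iff[OF that, of k k m \<theta>] interior_R_set_iff[OF that k'_def] k k' ne
    by (auto simp: \<tau>_def)
  have N: "finite N" "\<tau> (\<theta> k) \<in> N" "\<tau> (\<theta> k') \<in> N" using k k' by (auto simp: N_def)
  \<comment> \<open>Here k \<noteq> k_last enters. The inequality supplies the node above the jump
    for the majorant and the node below the jump for the minorant.\<close>
  have lt: "\<tau> (\<theta> k) < \<tau> (\<theta> k')" using succ[OF k(1)] by simp
  obtain Q where Q: "degree Q \<le> 2 * m - 2"
    "\<And>t. t \<in> N \<Longrightarrow> poly Q t = (if t \<le> \<tau> (\<theta> k) then 1 else 0)"
    "\<And>t. t \<notin> N \<Longrightarrow> poly Q t > (if t \<le> \<tau> (\<theta> k) then 1 else 0)"
    using step_majorant[OF N(1,2)] N(3) lt unfolding cardN by blast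
  obtain V where V: "degree V \<le> 2 * m - 2"
    "\<And>t. t \<in> N \<Longrightarrow> poly V t = (if t < \<tau> (\<theta> k') then 1 else 0)"
    "\<And>t. t \<notin> N \<Longrightarrow> poly V t < (if t < \<tau> (\<theta> k') then 1 else 0)"
    using step_minorant[OF N(1,3)] N(2) lt unfolding cardN by blast
  define r where "r P z = poly (map_poly complex_of_real P) (1 / (of_real s - z))" for P z
  \<comment> \<open>Real coefficients make the values on the real line real, so the complex order
    reduces to the real one.\<close>
  have r: "r P (of_real x) = of_real (poly P (\<tau> x))" for P x
    by (simp add: r_def \<tau>_def poly_altdef degree_map_poly coeff_map_poly)
  have "ratfun_at s m (r Q)" "ratfun_at s m (r V)"
    using ratfun_at_poly_inverse[OF Q(1)] ratfun_at_poly_inverse[OF V(1)] by (simp_all add: r_def[abs_def])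
  \<comment> \<open>The two polynomials jump at different nodes; \<open>succ\<close> shows that
    their values on the nodes nevertheless agree.\<close>
  moreover have "\<forall>j\<in>{1..m}. r Q (of_real (\<theta> j)) = (if j \<in> I_set \<theta> m s k then 1 else 0) \<and>
      r V (of_real (\<theta> j)) = (if j \<in> I_set \<theta> m s k then 1 else 0)"
    using Q(2) V(2) I succ by (auto simp: r N_def)
  moreover have strict: "\<forall>x :: real. x \<noteq> s \<and> x \<notin> \<theta> ` {1..m} \<longrightarrow>
         r Q (of_real x) > (if x \<in> R_set \<theta> m s k then 1 else 0) \<and>
         r V (of_real x) < (if x \<in> interior (R_set \<theta> m s (k + 1)) then 1 else 0)"
  proof (intro allI impI)
    fix x assume x: "x \<noteq> s \<and> x \<notin> \<theta> ` {1..m}"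
    then have "\<tau> x \<notin> N" by (auto simp: N_def \<tau>_inj)
    then show "r Q (of_real x) > (if x \<in> R_set \<theta> m s k then 1 else 0) \<and>
         r V (of_real x) < (if x \<in> interior (R_set \<theta> m s (k + 1)) then 1 else 0)"
      using Q(3)[of "\<tau> x"] V(3)[of "\<tau> x"] R[of x] x by (auto simp: r less_complex_def)
  qed
  moreover have "\<forall>x :: real. x \<noteq> s \<longrightarrow>
         r Q (of_real x) \<ge> (if x \<in> R_set \<theta> m s k then 1 else 0) \<and>
         r V (of_real x) \<le> (if x \<in> interior (R_set \<theta> m s (k + 1)) then 1 else 0)"
  proof (intro allI impI)
    fix x assume x: "x \<noteq> s"
    show "r Q (of_real x) \<ge> (if x \<in> R_set \<theta> m s k then 1 else 0) \<and>
         r V (of_real x) \<le> (if x \<in> interior (R_set \<theta> m s (k + 1)) then 1 else 0)"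
    proof (cases "x \<in> \<theta> ` {1..m}")
      case True
      then have "\<tau> x \<in> N" by (auto simp: N_def)
      then show ?thesis
        using Q(2)[of "\<tau> x"] V(2)[of "\<tau> x"] R[OF x] by (auto simp: r)
    next
      case False
      then show ?thesis using strict[rule_format, of x] x by (simp add: less_imp_le)
    qed
  qed
  ultimately show "\<exists>r_plus r_minus :: complex \<Rightarrow> complex.
      ratfun_at s m r_plus \<and> ratfun_at s m r_minus \<and>
      (\<forall>j \<in> {1..m}.
         r_plus (of_real (\<theta> j)) = (if j \<in> I_set \<theta> m s k then 1 else 0) \<and>
         r_minus (of_real (\<theta> j)) = (if j \<in> I_set \<theta> m s k then 1 else 0)) \<and>
      (\<forall>x :: real. x \<noteq> s \<longrightarrow>
         r_plus (of_real x) \<ge> (if x \<in> R_set \<theta> m s k then 1 else 0) \<and>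
         r_minus (of_real x) \<le> (if x \<in> interior (R_set \<theta> m s (k + 1)) then 1 else 0)) \<and>
      (\<forall>x :: real. x \<noteq> s \<and> x \<notin> \<theta> ` {1..m} \<longrightarrow>
         r_plus (of_real x) > (if x \<in> R_set \<theta> m s k then 1 else 0) \<and>
         r_minus (of_real x) < (if x \<in> interior (R_set \<theta> m s (k + 1)) then 1 else 0))"
    by (intro exI[of _ "r Q"] exI[of _ "r V"] conjI) assumption+
qed

end
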